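(* Let $p>1$ and $\frac1p+\frac1{p'}=1$. There exist weights $u$ and $v$ on $\mathbb{R}$ such that $$\sup_I\|u^{1/p}\|_{L^p(\log L)^{p-\frac12},I}\|v^{-1/p}\|_{L^{p'}(\log L)^{2p'-\frac12},I}<\infty$$ and $$\sup_I\|u^{1/p}\|_{L^p(\log L)^{2p-\frac12},I}\|v^{-1/p}\|_{L^{p'}(\log L)^{p'-\frac12},I}<\infty,$$ while $$\sup_I\|u^{1/p}\|_{L^p(\log L)^{2p-1},I}\|v^{-1/p}\|_{L^{p'}(\log L)^{2p'-1},I}=\infty,$$ where the suprema are over all bounded intervals $I\subset\mathbb{R}$.
   Context: A weight is a non-negative locally integrable function. For an interval $I$ and $q\ge1$, $\alpha\ge0$, $\|f\|_{L^q(\log L)^\alpha,I}=\inf\{\lambda>0:\frac1{|I|}\int_I\varphi(|f(y)|/\lambda)dy\le1\}$ with $\varphi(t)=t^q\log^\alpha(e+t)$. *)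

theory Defs
  imports "HOL-Analysis.Analysis"
begin

definition locally_integrable :: "(real \<Rightarrow> real) \<Rightarrow> bool" where
  "locally_integrable w \<longleftrightarrow> (\<forall>K. compact K \<longrightarrow> set_integrable lebesgue K w)"

definition weight :: "(real \<Rightarrow> real) \<Rightarrow> bool" where
  "weight w \<longleftrightarrow> (\<forall>x. 0 \<le> w x) \<and> locally_integrable w"

text \<open>A weight may vanish, so its negative powers are taken in \<^typ>\<open>ennreal\<close>, with value
  \<open>\<infinity>\<close> where the weight is zero (\<^term>\<open>(0::real) powr a\<close> is \<open>0\<close> for all \<open>a\<close>, also for
  negative \<open>a\<close>).\<close>

definition weight_power :: "(real \<Rightarrow> real) \<Rightarrow> real \<Rightarrow> real \<Rightarrow> ennreal" where
  "weight_power w a = (\<lambda>x. if w x = 0 \<and> a < 0 then \<infinity> else ennreal (w x powr a))"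

text \<open>The function \<open>t\<^sup>q log\<^sup>\<alpha> (e + t)\<close>, extended by \<open>\<infinity>\<close> at \<open>t = \<infinity>\<close>.\<close>

definition young_fun :: "real \<Rightarrow> real \<Rightarrow> ennreal \<Rightarrow> ennreal" where
  "young_fun q \<alpha> t =
     (if t = \<infinity> then \<infinity>
      else ennreal (enn2real t powr q * ln (exp 1 + enn2real t) powr \<alpha>))"

text \<open>The functions under consideration are non-negative, so \<open>f\<close> replaces its absolute value.
  The infimum is \<open>\<infinity>\<close> if no \<open>c\<close> is admissible.\<close>

definition llog_norm :: "real \<Rightarrow> real \<Rightarrow> real set \<Rightarrow> (real \<Rightarrow> ennreal) \<Rightarrow> ennreal" where
  "llog_norm q \<alpha> I f =
     Inf {ennreal c | c. 0 < c \<and>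
       (\<integral>\<^sup>+y\<in>I. young_fun q \<alpha> (f y / ennreal c) \<partial>lebesgue) / emeasure lebesgue I \<le> 1}"

text \<open>Open, closed and half-open intervals; the degenerate ones, over which there is no average,
  are excluded.\<close>

definition bounded_intervals :: "real set set" where
  "bounded_intervals = {I. is_interval I \<and> bounded I \<and> emeasure lebesgue I > 0}"

end

theory Submission
  imports Defs
begin

text \<open>Let \<open>u\<close> be the indicator of a union of unit intervals \<open>left n\<close>, and let \<open>v powr (-1/p)\<close> be \<open>1\<close>
  except on unit intervals \<open>right n\<close> at distance \<open>d = exp L\<close> from \<open>left n\<close>, where \<open>L = n + 1\<close>; there
  it is \<open>d L powr (-5/2)\<close>. On the shortest interval that contains \<open>left n\<close> and \<open>right n\<close>, the product
  of the norms with exponents \<open>\<alpha>\<close>, \<open>\<beta>\<close> of the logarithms is of order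
  \<open>L powr (\<alpha>/p + \<beta>/p' - 5/2)\<close>, up to a bounded term. The sum \<open>\<alpha>/p + \<beta>/p'\<close> is \<open>5/2\<close> for the first
  two pairs of exponents and \<open>3\<close> for the last one. If an interval misses all \<open>left n\<close>, the first norm
  vanishes; if it misses all \<open>right n\<close>, both functions are at most \<open>1\<close> on it. The gaps between different
  pairs are so large that on an interval that meets two pairs the averages stay bounded.\<close>

section \<open>Growth of the Young function and its approximate inverse\<close>

definition phi :: "real \<Rightarrow> real \<Rightarrow> real \<Rightarrow> real" where
  "phi q \<alpha> t = t powr q * ln (exp 1 + t) powr \<alpha>"

lemma ln_e_plus_ge_1: "1 \<le> ln (exp 1 + t)" if "0 \<le> t" for t :: real
proof -
  have "ln (exp 1) \<le> ln (exp 1 + t)"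
    using that by (subst ln_le_cancel_iff) (auto intro: add_pos_nonneg)
  then show ?thesis by simp
qed

lemma phi_nonneg: "0 \<le> phi q \<alpha> t"
  by (simp add: phi_def)

lemma phi_mono:
  assumes "0 < q" "0 \<le> \<alpha>" "0 \<le> s" "s \<le> t"
  shows "phi q \<alpha> s \<le> phi q \<alpha> t"
proof -
  have "ln (exp 1 + s) \<le> ln (exp 1 + t)"
    using assms by (subst ln_le_cancel_iff) (auto intro: add_pos_nonneg)
  with assms ln_e_plus_ge_1[of s] show ?thesis
    unfolding phi_def by (intro mult_mono powr_mono2) auto
qed

lemma phi_mono_exponent:
  assumes "\<alpha> \<le> \<beta>" "0 \<le> t"
  shows "phi q \<alpha> t \<le> phi q \<beta> t"
  unfolding phi_def using assms ln_e_plus_ge_1[of t]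
  by (intro mult_left_mono powr_mono) auto

lemma phi_pos: "0 < phi q \<alpha> t" if "0 < t"
  using that ln_e_plus_ge_1[of t] by (simp add: phi_def)

lemma young_fun_ennreal: "young_fun q \<alpha> (ennreal t) = ennreal (phi q \<alpha> t)" if "0 \<le> t"
  using that by (simp add: young_fun_def phi_def)

lemma young_fun_inverse: "young_fun q \<alpha> (1 / ennreal c) = ennreal (phi q \<alpha> (1 / c))" if "0 < c"
  using that young_fun_ennreal[of "1 / c"] divide_ennreal[of 1 c] by simp

text \<open>For \<open>t \<le> exp L\<close> and \<open>L \<ge> 1\<close>, the sum
  \<open>exp 1 + t\<close> is at most \<open>exp (2 * L)\<close>, so the logarithm is at most
  \<open>2 * L\<close>.\<close>

lemma phi_le_powr:
  assumes "0 \<le> \<alpha>" "1 \<le> L" "0 \<le> t" "t \<le> exp L"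
  shows "phi q \<alpha> t \<le> t powr q * (2 * L) powr \<alpha>"
proof -
  have "exp 1 \<le> exp L" using assms by simp
  then have "exp 1 + t \<le> 2 * exp L" using assms by linarith
  also have "\<dots> \<le> exp L * exp L"
  proof (rule mult_right_mono)
    show "2 \<le> exp L" using assms exp_ge_add_one_self[of L] by linarith
  qed simp
  also have "\<dots> = exp (2 * L)" by (simp flip: exp_add)
  finally have "ln (exp 1 + t) \<le> ln (exp (2 * L))"
    using assms by (subst ln_le_cancel_iff) (auto intro: add_pos_nonneg)
  then show ?thesis
    using assms ln_e_plus_ge_1[of t] unfolding phi_def
    by (intro mult_left_mono powr_mono2) auto
qed

text \<open>Up to constants, the inverse function of \<^term>\<open>phi q \<alpha>\<close> at the point \<^term>\<open>exp L\<close>.\<close>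

definition level :: "real \<Rightarrow> real \<Rightarrow> real \<Rightarrow> real" where
  "level q \<alpha> L = exp (L / q) * L powr (- \<alpha> / q)"

text \<open>Dividing the argument by this constant gains the factor
  \<open>1 / (2 * 2 powr \<alpha>)\<close>: the power of \<open>2\<close> cancels the one in
  \<open>(2 * L) powr \<alpha>\<close>, and the remaining \<open>1 / 2\<close> lets two
  contributions share an average of at most \<open>1\<close>.\<close>

definition slack :: "real \<Rightarrow> real \<Rightarrow> real" where
  "slack q \<alpha> = 2 powr ((\<alpha> + 1) / q)"

lemma slack_ge_1: "1 \<le> slack q \<alpha>" if "0 < q" "0 \<le> \<alpha>"
  using that by (simp add: slack_def ge_one_powr_ge_zero)

lemma slack_powr: "slack q \<alpha> powr q = 2 * 2 powr \<alpha>" if "0 < q"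
  using that by (simp add: slack_def powr_powr powr_add)

lemma level_pos: "0 < level q \<alpha> L" if "0 < L"
  using that by (simp add: level_def)

lemma level_powr: "level q \<alpha> L powr q = exp L * L powr (- \<alpha>)" if "0 < q" "0 < L"
  using that by (simp add: level_def powr_mult powr_powr) (simp add: powr_def)

lemma phi_inverse_slack:
  assumes "0 < q" "0 \<le> \<alpha>"
  shows "phi q \<alpha> (1 / slack q \<alpha>) \<le> 1 / 2"
proof -
  have s: "1 \<le> slack q \<alpha>" by (rule slack_ge_1) fact+
  then have "1 / slack q \<alpha> \<le> 1" by simp
  also have "1 \<le> exp (1::real)" by simp
  finally have "phi q \<alpha> (1 / slack q \<alpha>) \<le> (1 / slack q \<alpha>) powr q * (2 * 1) powr \<alpha>"
    using assms s by (intro phi_le_powr) auto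
  also have "\<dots> = 1 / 2"
    using assms s by (simp add: powr_divide slack_powr)
  finally show ?thesis .
qed

text \<open>Since \<open>level q \<alpha> L \<le> exp L\<close>, the logarithm is at most
  \<open>2 * L\<close>; the factor \<open>L powr (- \<alpha>)\<close> in \<open>level_powr\<close>
  and \<open>slack\<close> absorb its power.\<close>

lemma phi_level_slack:
  assumes "1 \<le> q" "0 \<le> \<alpha>" "1 \<le> L"
  shows "phi q \<alpha> (level q \<alpha> L / slack q \<alpha>) \<le> exp L / 2"
proof -
  have s: "1 \<le> slack q \<alpha>" using assms by (intro slack_ge_1) auto
  have l: "0 < level q \<alpha> L" using assms by (intro level_pos) auto
  have "level q \<alpha> L / slack q \<alpha> \<le> level q \<alpha> L"
    using s l by (simp add: divide_le_eq)
  also have "\<dots> \<le> exp L * 1"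
  proof -
    have "L powr (- \<alpha> / q) \<le> L powr 0"
      using assms by (intro powr_mono) auto
    then show ?thesis
      using assms unfolding level_def by (intro mult_mono) (auto simp: divide_le_eq mult_left_le)
  qed
  finally have "phi q \<alpha> (level q \<alpha> L / slack q \<alpha>)
      \<le> (level q \<alpha> L / slack q \<alpha>) powr q * (2 * L) powr \<alpha>"
    using assms s l by (intro phi_le_powr) auto
  also have "\<dots> = exp L / 2"
    using assms s l
    by (simp add: powr_divide slack_powr level_powr powr_mult powr_minus field_simps)
  finally show ?thesis .
qed

text \<open>The exponential dominates the power of \<open>L\<close>: raise
  \<open>L / \<alpha> \<le> exp (L / \<alpha>)\<close> to the power \<open>\<alpha> / q\<close>.
  This controls the bounded extra term in the product of the norms.\<close>

lemma inverse_level_bounded: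
  assumes "0 < q" "0 < \<alpha>" "1 \<le> L"
  shows "1 / level q \<alpha> L \<le> \<alpha> powr (\<alpha> / q)"
proof -
  have "L / \<alpha> \<le> exp (L / \<alpha>)" using exp_ge_add_one_self[of "L / \<alpha>"] by linarith
  then have "(L / \<alpha>) powr (\<alpha> / q) \<le> exp (L / \<alpha>) powr (\<alpha> / q)"
    using assms by (intro powr_mono2) auto
  also have "\<dots> = exp (L / q)" using assms by (simp add: powr_def)
  finally have "L powr (\<alpha> / q) \<le> \<alpha> powr (\<alpha> / q) * exp (L / q)"
    using assms by (simp add: powr_divide field_simps)
  then show ?thesis
    using assms by (simp add: level_def powr_minus field_simps)
qed

text \<open>Converse to \<open>phi_level_slack\<close> up to a constant. For large \<open>L\<close>
  the logarithm of \<open>level q \<alpha> L\<close> is at least \<open>L / (2 * q)\<close>, so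
  beyond a multiple of that level the Young function exceeds \<open>2 * exp L\<close>.\<close>

lemma phi_le_imp_le_level:
  assumes "0 < q" "0 \<le> \<alpha>"
  shows "\<exists>A>0. \<forall>\<^sub>F L in at_top. \<forall>t\<ge>0. phi q \<alpha> t \<le> 2 * exp L \<longrightarrow> t \<le> A * level q \<alpha> L"
proof -
  \<comment> \<open>\<open>(2 * q) powr \<alpha>\<close> compensates for the logarithm being bounded
    below only by \<open>L / (2 * q)\<close>, the \<open>2\<close> is the one in
    \<open>2 * exp L\<close>, and the added \<open>1\<close> makes the final inequality
    strict.\<close>
  define A where "A = (1 + 2 * (2 * q) powr \<alpha>) powr (1 / q)"
  have pos: "0 < (2 * q) powr \<alpha>" using assms by simp
  have A: "A powr q = 1 + 2 * (2 * q) powr \<alpha>"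
    using assms pos by (simp add: A_def powr_powr)
  have A1: "1 \<le> A" unfolding A_def
    using assms pos by (intro ge_one_powr_ge_zero) auto
  have "((\<lambda>L. ln L / L) \<longlongrightarrow> (0::real)) at_top"
    by (rule ln_x_over_x_tendsto_0)
  \<comment> \<open>The aim is \<open>2 * \<alpha> * ln L \<le> L\<close>; the \<open>+ 1\<close>
    keeps the denominator positive when \<open>\<alpha> = 0\<close>.\<close>
  then have "\<forall>\<^sub>F L in at_top. ln L / L < (1 / (2 * \<alpha> + 1) :: real)"
    using assms by (intro order_tendstoD) auto
  moreover have "\<forall>\<^sub>F L in at_top. (1::real) \<le> L" by (rule eventually_ge_at_top)
  ultimately have "\<forall>\<^sub>F L in at_top. \<forall>t\<ge>0. phi q \<alpha> t \<le> 2 * exp L \<longrightarrow> t \<le> A * level q \<alpha> L"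
  proof eventually_elim
    case (elim L)
    have "ln L * (2 * \<alpha> + 1) < L"
      using elim assms by (simp add: field_simps)
    moreover have "0 \<le> ln L" using elim by simp
    ultimately have lnL: "2 * \<alpha> * ln L \<le> L" by (simp add: algebra_simps)
    have l: "0 < level q \<alpha> L" using elim by (intro level_pos) auto
    have "ln (level q \<alpha> L) = L / q - \<alpha> / q * ln L"
      using elim assms by (simp add: level_def ln_mult ln_powr)
    also have "\<dots> \<ge> L / (2 * q)"
      using lnL assms by (simp add: field_simps)
    finally have ln_level: "L / (2 * q) \<le> ln (level q \<alpha> L)" .
    have "\<not> phi q \<alpha> t \<le> 2 * exp L" if t: "A * level q \<alpha> L < t" for t
    proof -
      have "level q \<alpha> L \<le> A * level q \<alpha> L"
        using A1 l by simp
      then have "level q \<alpha> L \<le> exp 1 + A * level q \<alpha> L"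
        by (simp add: add_increasing)
      then have ln': "L / (2 * q) \<le> ln (exp 1 + A * level q \<alpha> L)"
        using ln_level l by (smt (verit) ln_le_cancel_iff)
      have "2 * exp L < (1 + 2 * (2 * q) powr \<alpha>) * exp L / (2 * q) powr \<alpha>"
        using pos by (simp add: field_simps)
      also have "\<dots> = (A * level q \<alpha> L) powr q * (L / (2 * q)) powr \<alpha>"
        using A A1 l elim assms
        by (simp add: powr_mult level_powr powr_minus powr_divide field_simps)
      also have "\<dots> \<le> phi q \<alpha> (A * level q \<alpha> L)"
        unfolding phi_def using ln' elim assms by (intro mult_left_mono powr_mono2) auto
      also have "\<dots> \<le> phi q \<alpha> t"
        using t assms A1 l by (intro phi_mono) auto
      finally show ?thesis by simp
    qed
    then show ?case by force
  qed
  then show ?thesis using A1 by (intro exI[of _ A]) auto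
qed

section \<open>Interval lengths and bounds for the Luxemburg norm\<close>

lemma bounded_intervals_emeasure:
  assumes "J \<in> bounded_intervals"
  obtains D where "0 < D" "J \<in> sets lebesgue" "emeasure lebesgue J = ennreal D"
    "\<And>y z. y \<in> J \<Longrightarrow> z \<in> J \<Longrightarrow> z - y \<le> D"
proof -
  have iv: "is_interval J" and bd: "bounded J" and pos: "emeasure lebesgue J > 0"
    using assms by (auto simp: bounded_intervals_def)
  have meas: "J \<in> sets lebesgue"
    using iv bd by (intro fmeasurableD measurable_convex is_interval_convex)
  then have "J \<in> lmeasurable"
    using bd by (simp add: bounded_set_imp_lmeasurable)
  then have eq: "emeasure lebesgue J = ennreal (measure lebesgue J)"
    by (simp add: emeasure_eq_measure2)
  show thesis
  proof
    show "0 < measure lebesgue J" using pos eq by simp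
    fix y z assume yz: "y \<in> J" "z \<in> J"
    show "z - y \<le> measure lebesgue J"
    proof (cases "y \<le> z")
      case True
      have "{y..z} \<subseteq> J"
        using iv yz unfolding is_interval_1 by fastforce
      then have "emeasure lebesgue {y..z} \<le> emeasure lebesgue J"
        using meas by (intro emeasure_mono)
      then show ?thesis using True eq by simp
    qed (use measure_nonneg[of lebesgue J] in linarith)
  qed (use meas eq in auto)
qed

lemma llog_norm_le:
  assumes "J \<in> bounded_intervals" "0 < c"
    "(\<integral>\<^sup>+y\<in>J. young_fun q \<alpha> (f y / ennreal c) \<partial>lebesgue) \<le> emeasure lebesgue J"
  shows "llog_norm q \<alpha> J f \<le> ennreal c"
proof -
  obtain D where "0 < D" "emeasure lebesgue J = ennreal D"
    using bounded_intervals_emeasure[OF assms(1)] by metis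
  then have "(\<integral>\<^sup>+y\<in>J. young_fun q \<alpha> (f y / ennreal c) \<partial>lebesgue) / emeasure lebesgue J \<le> 1"
    using assms(3) by (intro divide_le_posI_ennreal) auto
  then show ?thesis
    unfolding llog_norm_def using assms(2) by (intro Inf_lower) auto
qed

text \<open>For an admissible \<open>c\<close>, the part \<open>S\<close> of measure one alone
  forces \<open>phi q \<alpha> (h / c) \<le> D\<close>, hence \<open>h / c \<le> T\<close>.\<close>

lemma le_llog_norm:
  assumes J: "J \<in> bounded_intervals" "emeasure lebesgue J \<le> ennreal D" "0 \<le> D"
    and S: "S \<in> sets lebesgue" "S \<subseteq> J" "emeasure lebesgue S = 1"
    and f: "\<And>y. y \<in> S \<Longrightarrow> f y = ennreal h" "0 \<le> h"
    and large: "\<And>t. 0 \<le> t \<Longrightarrow> phi q \<alpha> t \<le> D \<Longrightarrow> t \<le> T" "0 < T"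
  shows "ennreal (h / T) \<le> llog_norm q \<alpha> J f"
  unfolding llog_norm_def
proof (rule Inf_greatest, safe)
  fix c :: real
  assume c: "0 < c"
    and le: "(\<integral>\<^sup>+y\<in>J. young_fun q \<alpha> (f y / ennreal c) \<partial>lebesgue) / emeasure lebesgue J \<le> 1"
  obtain D' where D': "0 < D'" "emeasure lebesgue J = ennreal D'"
    using bounded_intervals_emeasure[OF J(1)] by metis
  have "ennreal (phi q \<alpha> (h / c)) = (\<integral>\<^sup>+y. ennreal (phi q \<alpha> (h / c)) * indicator S y \<partial>lebesgue)"
    using S by (simp add: nn_integral_cmult_indicator)
  also have "\<dots> \<le> (\<integral>\<^sup>+y\<in>J. young_fun q \<alpha> (f y / ennreal c) \<partial>lebesgue)"
    using S(2) f c
    by (intro nn_integral_mono)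
       (auto simp: indicator_def divide_ennreal young_fun_ennreal)
  also have "\<dots> \<le> emeasure lebesgue J"
  proof -
    let ?X = "\<integral>\<^sup>+y\<in>J. young_fun q \<alpha> (f y / ennreal c) \<partial>lebesgue"
    have "?X = ?X / ennreal D' * ennreal D'"
      using D'(1) by (simp add: ennreal_divide_times)
    also have "\<dots> \<le> 1 * ennreal D'"
      using le D' by (intro mult_right_mono) auto
    finally show ?thesis using D' by simp
  qed
  also have "\<dots> \<le> ennreal D" by (rule J)
  finally have "phi q \<alpha> (h / c) \<le> D" using J(3) by (simp add: ennreal_le_iff)
  then have "h / c \<le> T" using c f(2) by (intro large) auto
  then show "ennreal (h / T) \<le> ennreal c"
    using c large(2) by (intro ennreal_leI) (simp add: field_simps)
qed


section \<open>Heights of the spikes\<close>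

definition height :: "nat \<Rightarrow> real" where
  "height n = exp (real (Suc n)) * real (Suc n) powr (- 5 / 2)"

lemma height_ge_1: "1 \<le> height n"
proof -
  let ?L = "real (Suc n)"
  have "5 / 2 \<le> exp (1::real)"
    using exp_lower_Taylor_quadratic[of 1] by simp
  \<comment> \<open>This multiplies \<open>5 / 2 \<le> exp 1\<close> by
    \<open>s \<le> exp (s - 1)\<close> for \<open>s = 2 * L / 5\<close>.\<close>
  then have "5 / 2 * (?L * 2 / 5) \<le> exp 1 * exp (?L * 2 / 5 - 1)"
    using exp_ge_add_one_self[of "?L * 2 / 5 - 1"] by (intro mult_mono) auto
  then have "?L \<le> exp (?L * 2 / 5)"
    by (simp flip: exp_add)
  then have "?L powr (5 / 2) \<le> exp (?L * 2 / 5) powr (5 / 2)"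
    by (intro powr_mono2) auto
  also have "\<dots> = exp ?L" by (simp add: powr_def)
  finally show ?thesis
    by (simp add: height_def powr_minus field_simps)
qed

lemma level_mult_level:
  assumes "1 / p + 1 / q = 1"
  shows "level p \<alpha> L * level q \<beta> L = exp L * L powr (- (\<alpha> / p + \<beta> / q))"
proof -
  have "level p \<alpha> L * level q \<beta> L = exp (L * (1 / p + 1 / q)) * L powr (- (\<alpha> / p + \<beta> / q))"
    unfolding distrib_left
    by (simp add: level_def exp_add powr_add powr_diff powr_minus field_simps)
  then show ?thesis using assms by simp
qed

text \<open>The product of the levels depends on the exponents only through
  \<open>\<alpha> / p + \<beta> / q\<close>, so one choice of heights serves both finite
  suprema.\<close>

lemma height_eq_levels:
  assumes "\<alpha> / p + \<beta> / q = 5 / 2" "1 / p + 1 / q = 1"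
  shows "level p \<alpha> (real (Suc n)) * level q \<beta> (real (Suc n)) = height n"
  unfolding level_mult_level[OF assms(2)] assms(1) by (simp add: height_def)

section \<open>The configuration of blocks and the two weights\<close>

locale spikes =
  fixes p q :: real and x :: "nat \<Rightarrow> real"
  assumes p: "1 < p" and q: "1 < q" and conjugate: "1 / p + 1 / q = 1"
    \<comment> \<open>The empty stretch after a block is at least twice the total Young integral of
      all spikes up to the next one. The exponent \<open>2 * q\<close> dominates every
      \<open>\<beta>\<close> for which finiteness is claimed.\<close>
    and gap: "x n + exp (real (Suc n)) + 2 + 2 * (\<Sum>j\<le>Suc n. phi q (2 * q) (height j)) \<le> x (Suc n)"
begin

definition left :: "nat \<Rightarrow> real set" where
  "left n = {x n..x n + 1}"

definition right :: "nat \<Rightarrow> real set" where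
  "right n = {x n + exp (real (Suc n)) + 1..x n + exp (real (Suc n)) + 2}"

definition block :: "nat \<Rightarrow> real set" where
  "block n = {x n..x n + exp (real (Suc n)) + 2}"

definition u :: "real \<Rightarrow> real" where
  "u = indicator (\<Union>n. left n)"

text \<open>The power \<open>- p\<close> makes \<open>v powr (-1/p)\<close> equal to the height. The
  sets \<open>right n\<close> are disjoint by \<open>block_unique\<close>, so \<open>LEAST\<close>
  picks the only index.\<close>

definition v :: "real \<Rightarrow> real" where
  "v y = (if y \<in> (\<Union>n. right n) then height (LEAST n. y \<in> right n) powr - p else 1)"

lemma left_subset_block: "left n \<subseteq> block n"
  by (auto simp: left_def block_def intro: order_trans)

lemma right_subset_block: "right n \<subseteq> block n"
  by (auto simp: right_def block_def intro: order_trans add_increasing2)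

lemma lebesgue_right: "right n \<in> sets lebesgue" "emeasure lebesgue (right n) = 1"
  by (simp_all add: right_def)

lemma sum_phi_pos: "0 < (\<Sum>j\<le>n. phi q (2 * q) (height j))"
  by (intro sum_pos phi_pos) (auto intro: less_le_trans[OF zero_less_one height_ge_1])

lemma block_end_mono:
  assumes "m \<le> n"
  shows "x m + exp (real (Suc m)) \<le> x n + exp (real (Suc n))"
  using assms
proof (induction rule: dec_induct)
  case (step k)
  have "0 < exp (real (Suc (Suc k)))" by simp
  with step gap[of k] sum_phi_pos[of "Suc k"] show ?case by linarith
qed simp

text \<open>Block \<open>m\<close> ends no later than the predecessor of block \<open>n\<close>, and
  \<open>gap\<close> separates that predecessor from block \<open>n\<close>.\<close>

lemma separated:
  assumes "m < n" "y \<in> block m" "z \<in> block n"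
  shows "2 * (\<Sum>j\<le>n. phi q (2 * q) (height j)) \<le> z - y"
proof -
  obtain k where k: "n = Suc k" "m \<le> k"
    using assms(1) by (cases n) auto
  then show ?thesis
    using assms block_end_mono[OF k(2)] gap[of k] unfolding block_def
    by simp
qed

text \<open>A common point of two different blocks would make the positive sum in
  \<open>separated\<close> at most \<open>0\<close>.\<close>

lemma block_unique:
  assumes "y \<in> block m" "y \<in> block n"
  shows "m = n"
  using separated[of m n y y] separated[of n m y y] sum_phi_pos[of m] sum_phi_pos[of n] assms
  by (cases m n rule: linorder_cases) auto

lemma x_ge: "x 0 + real n \<le> x n"
proof (induction n)
  case (Suc n)
  have "0 < exp (real (Suc n))" by simp
  with Suc gap[of n] sum_phi_pos[of "Suc n"] show ?case
    by (simp del: sum.atMost_Suc exp_gt_zero)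
qed simp

text \<open>By \<open>x_ge\<close> the blocks move to infinity. Hence an interval that meets several
  blocks has a last one.\<close>

lemma finite_blocks:
  assumes "bounded J"
  shows "finite {n. J \<inter> block n \<noteq> {}}"
proof -
  obtain M where M: "\<And>y. y \<in> J \<Longrightarrow> \<bar>y\<bar> \<le> M"
    using assms unfolding bounded_iff by auto
  have "n \<le> nat \<lceil>M - x 0\<rceil>" if ne: "J \<inter> block n \<noteq> {}" for n
  proof -
    obtain y where "y \<in> J" "x n \<le> y" using ne unfolding block_def by fastforce
    with M[of y] x_ge[of n] have "real n \<le> M - x 0" by linarith
    then show ?thesis by linarith
  qed
  then show ?thesis
    by (intro finite_subset[OF _ finite_atMost[of "nat \<lceil>M - x 0\<rceil>"]]) auto
qed

lemma v_right:
  assumes "y \<in> right n"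
  shows "v y = height n powr - p"
proof -
  have "(LEAST n. y \<in> right n) = n"
    using assms block_unique right_subset_block
    by (intro Least_equality) (auto dest!: subsetD[OF right_subset_block] dest: block_unique)
  then show ?thesis using assms by (auto simp: v_def)
qed

lemma v_bounds: "0 < v y" "v y \<le> 1"
proof -
  have h: "0 < height n" "height n powr - p \<le> 1" for n
  proof -
    have "height n powr - p \<le> height n powr 0"
      using p height_ge_1[of n] by (intro powr_mono) auto
    then show "height n powr - p \<le> 1" "0 < height n"
      using height_ge_1[of n] by auto
  qed
  then show "0 < v y" "v y \<le> 1"
    by (auto simp: v_def order_less_imp_not_eq2)
qed

lemma weight_bounded:
  assumes "w \<in> borel_measurable borel" "\<And>y. 0 \<le> w y" "\<And>y. w y \<le> 1"
  shows "weight w"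
  unfolding weight_def locally_integrable_def set_integrable_def
proof (intro conjI allI impI integrableI_bounded_set_indicator)
  fix K :: "real set" assume K: "compact K"
  then show "K \<in> sets lebesgue" "emeasure lebesgue K < \<infinity>"
    using lmeasurable_compact[OF K] by (auto simp: fmeasurable_def)
  show "w \<in> borel_measurable lebesgue"
    using assms(1) by (intro measurable_completion) simp
  show "AE y in lebesgue. y \<in> K \<longrightarrow> norm (w y) \<le> 1"
    using assms by simp
qed (rule assms)

lemma weight_u: "weight u"
  unfolding u_def by (rule weight_bounded) (auto simp: left_def indicator_def)

lemma weight_v: "weight v"
proof (rule weight_bounded)
  have [measurable]: "right n \<in> sets borel" for n
    by (simp add: right_def)
  have "(\<lambda>y. height (LEAST n. y \<in> right n) powr - p) \<in> borel_measurable borel"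
    by (rule measurable_compose[where g = "\<lambda>n. height n powr - p" and N = "count_space UNIV"])
       measurable
  then show "v \<in> borel_measurable borel"
    unfolding v_def by measurable
qed (use v_bounds in \<open>auto intro: less_imp_le\<close>)

lemma weight_power_u: "weight_power u (1 / p) y = indicator (\<Union>n. left n) y"
  using p by (auto simp: weight_power_def u_def indicator_def)

lemma weight_power_v_right:
  assumes "y \<in> right n"
  shows "weight_power v (- (1 / p)) y = ennreal (height n)"
proof -
  have "v y powr (- (1 / p)) = height n"
    using p height_ge_1[of n] v_right[OF assms] by (simp add: powr_powr)
  then show ?thesis using v_bounds(1)[of y] by (simp add: weight_power_def)
qed

lemma weight_power_v_outside:
  assumes "y \<notin> (\<Union>n. right n)"
  shows "weight_power v (- (1 / p)) y = 1"
  using assms by (simp add: weight_power_def v_def)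

section \<open>Upper bounds for the two norms\<close>

text \<open>On \<open>J\<close> the function is \<open>0\<close> off \<open>S\<close> and at most
  \<open>1\<close> on it. The covering set \<open>S\<close> is free, so that \<open>J\<close>, a
  single \<open>left n\<close> and the empty set can be used.\<close>

lemma llog_norm_u_le:
  assumes J: "J \<in> bounded_intervals" "emeasure lebesgue J = ennreal D" "0 \<le> D"
    and c: "0 < c"
    and S: "S \<in> sets lebesgue" "J \<inter> (\<Union>n. left n) \<subseteq> S"
    and le: "ennreal (phi p \<alpha> (1 / c)) * emeasure lebesgue S \<le> ennreal D"
  shows "llog_norm p \<alpha> J (weight_power u (1 / p)) \<le> ennreal c"
proof (rule llog_norm_le[OF J(1) c])
  have "(\<integral>\<^sup>+y\<in>J. young_fun p \<alpha> (weight_power u (1 / p) y / ennreal c) \<partial>lebesgue)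
      \<le> (\<integral>\<^sup>+y. ennreal (phi p \<alpha> (1 / c)) * indicator S y \<partial>lebesgue)"
  proof (rule nn_integral_mono)
    fix y
    have "young_fun p \<alpha> (0 / ennreal c) = 0"
      using p by (simp add: young_fun_def)
    moreover have "young_fun p \<alpha> (1 / ennreal c) = ennreal (phi p \<alpha> (1 / c))"
      using c by (simp add: young_fun_inverse)
    ultimately show "young_fun p \<alpha> (weight_power u (1 / p) y / ennreal c) * indicator J y
        \<le> ennreal (phi p \<alpha> (1 / c)) * indicator S y"
      using S(2) by (auto simp: weight_power_u indicator_def)
  qed
  also have "\<dots> = ennreal (phi p \<alpha> (1 / c)) * emeasure lebesgue S"
    using S(1) by (simp add: nn_integral_cmult_indicator)
  finally show "(\<integral>\<^sup>+y\<in>J. young_fun p \<alpha> (weight_power u (1 / p) y / ennreal c) \<partial>lebesgue)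
      \<le> emeasure lebesgue J"
    using le J(2) by simp
qed

text \<open>The background value \<open>1\<close> and the spikes each use at most half of the
  measure \<open>D\<close>. Every spike has width one and is counted in full, even if
  \<open>J\<close> contains only part of it.\<close>

lemma llog_norm_v_le:
  assumes J: "J \<in> bounded_intervals" "emeasure lebesgue J = ennreal D" "0 \<le> D"
    and c: "0 < c" "phi q \<beta> (1 / c) \<le> 1 / 2"
    and S: "finite S" "\<And>y n. y \<in> J \<Longrightarrow> y \<in> right n \<Longrightarrow> n \<in> S"
    and le: "(\<Sum>n\<in>S. phi q \<beta> (height n / c)) \<le> D / 2"
  shows "llog_norm q \<beta> J (weight_power v (- 1 / p)) \<le> ennreal c"
proof (rule llog_norm_le[OF J(1) c(1)])
  have Jm: "J \<in> sets lebesgue"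
    using bounded_intervals_emeasure[OF J(1)] by metis
  have h: "0 \<le> height n" for n
    using height_ge_1[of n] by linarith
  have "(\<integral>\<^sup>+y\<in>J. young_fun q \<beta> (weight_power v (- 1 / p) y / ennreal c) \<partial>lebesgue)
      \<le> (\<integral>\<^sup>+y. ennreal (phi q \<beta> (1 / c)) * indicator J y
            + (\<Sum>n\<in>S. ennreal (phi q \<beta> (height n / c)) * indicator (right n) y) \<partial>lebesgue)"
  proof (rule nn_integral_mono)
    fix y
    show "young_fun q \<beta> (weight_power v (- 1 / p) y / ennreal c) * indicator J y
      \<le> ennreal (phi q \<beta> (1 / c)) * indicator J y
            + (\<Sum>n\<in>S. ennreal (phi q \<beta> (height n / c)) * indicator (right n) y)"
    proof (cases "y \<in> J \<and> y \<in> (\<Union>n. right n)")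
      case True
      then obtain n where n: "y \<in> J" "y \<in> right n" by auto
      have "young_fun q \<beta> (weight_power v (- 1 / p) y / ennreal c) * indicator J y
          = ennreal (phi q \<beta> (height n / c)) * indicator (right n) y"
        using n c h[of n]
        by (simp add: weight_power_v_right divide_ennreal young_fun_ennreal)
      also have "\<dots> \<le> (\<Sum>n\<in>S. ennreal (phi q \<beta> (height n / c)) * indicator (right n) y)"
        using S n by (intro member_le_sum) auto
      finally show ?thesis by (simp add: add_increasing)
    next
      case False
      have "young_fun q \<beta> (1 / ennreal c) = ennreal (phi q \<beta> (1 / c))"
        using c by (simp add: young_fun_inverse)
      with False show ?thesis
        by (cases "y \<in> J") (auto simp: weight_power_v_outside add_increasing2)
    qed
  qed
  also have "\<dots> = ennreal (phi q \<beta> (1 / c)) * ennreal D + (\<Sum>n\<in>S. ennreal (phi q \<beta> (height n / c)))"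
    using Jm lebesgue_right J
    by (simp add: nn_integral_add nn_integral_sum nn_integral_cmult_indicator)
  also have "\<dots> = ennreal (phi q \<beta> (1 / c) * D + (\<Sum>n\<in>S. phi q \<beta> (height n / c)))"
    using J(3) by (simp add: phi_nonneg sum_nonneg flip: ennreal_mult ennreal_plus)
  also have "\<dots> \<le> ennreal D"
  proof (rule ennreal_leI)
    have "phi q \<beta> (1 / c) * D \<le> 1 / 2 * D"
      using c J by (intro mult_right_mono) auto
    with le show "phi q \<beta> (1 / c) * D + (\<Sum>n\<in>S. phi q \<beta> (height n / c)) \<le> D" by simp
  qed
  finally show "(\<integral>\<^sup>+y\<in>J. young_fun q \<beta> (weight_power v (- 1 / p) y / ennreal c) \<partial>lebesgue)
      \<le> emeasure lebesgue J"
    using J by simp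
qed

section \<open>Uniform bound for the product when the exponents sum to 5/2\<close>

lemma norm_product_le:
  assumes J: "J \<in> bounded_intervals"
    and \<alpha>: "0 < \<alpha>" and \<beta>: "0 \<le> \<beta>" "\<beta> \<le> 2 * q" and sum: "\<alpha> / p + \<beta> / q = 5 / 2"
  shows "llog_norm p \<alpha> J (weight_power u (1 / p)) * llog_norm q \<beta> J (weight_power v (- 1 / p))
    \<le> ennreal (slack p \<alpha> * slack q \<beta> * (1 + \<alpha> powr (\<alpha> / p)))"
    (is "?U * ?V \<le> ennreal (?A * ?B * (1 + ?K))")
proof -
  obtain D where D: "0 < D" "J \<in> sets lebesgue" "emeasure lebesgue J = ennreal D"
    "\<And>y z. y \<in> J \<Longrightarrow> z \<in> J \<Longrightarrow> z - y \<le> D"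
    using bounded_intervals_emeasure[OF J] by metis
  have A: "1 \<le> ?A" and B: "1 \<le> ?B"
    using p q \<alpha> \<beta> by (auto intro!: slack_ge_1)
  have phi_A: "phi p \<alpha> (1 / ?A) \<le> 1 / 2" and phi_B: "phi q \<beta> (1 / ?B) \<le> 1 / 2"
    by (rule phi_inverse_slack; use p q \<alpha> \<beta> in simp)+
  have h: "0 < height n" for n using height_ge_1[of n] by linarith
  \<comment> \<open>Each norm is bounded by its \<open>slack\<close> whenever the spikes in
    \<open>J\<close> are negligible against its length. This covers the cases
    \<open>no_right\<close> and \<open>many\<close>.\<close>
  have crude: "?U * ?V \<le> ennreal (?A * ?B * (1 + ?K))"
    if S: "finite S" "\<And>y n. y \<in> J \<Longrightarrow> y \<in> right n \<Longrightarrow> n \<in> S"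
      and le: "2 * (\<Sum>n\<in>S. phi q (2 * q) (height n)) \<le> D" for S
  proof -
    have "ennreal (phi p \<alpha> (1 / ?A)) * emeasure lebesgue J \<le> 1 * emeasure lebesgue J"
      using phi_A by (intro mult_right_mono) auto
    then have "?U \<le> ennreal ?A"
      using D J A \<alpha> by (intro llog_norm_u_le[where S = J and D = D]) auto
    moreover have "?V \<le> ennreal ?B"
    proof (rule llog_norm_v_le[OF J D(3) _ _ phi_B S])
      have "phi q \<beta> (height n / ?B) \<le> phi q (2 * q) (height n)" for n
      proof -
        have "height n / ?B \<le> height n" using B h[of n] by (simp add: divide_le_eq)
        then have "phi q \<beta> (height n / ?B) \<le> phi q \<beta> (height n)"
          using q \<beta> B h[of n] by (intro phi_mono) auto
        also have "\<dots> \<le> phi q (2 * q) (height n)"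
          using \<beta> h[of n] by (intro phi_mono_exponent) auto
        finally show ?thesis .
      qed
      then have "(\<Sum>n\<in>S. phi q \<beta> (height n / ?B)) \<le> (\<Sum>n\<in>S. phi q (2 * q) (height n))"
        by (intro sum_mono)
      with le show "(\<Sum>n\<in>S. phi q \<beta> (height n / ?B)) \<le> D / 2" by simp
    qed (use D B in auto)
    ultimately have "?U * ?V \<le> ennreal ?A * ennreal ?B"
      by (intro mult_mono) auto
    also have "\<dots> = ennreal (?A * ?B)" using A B by (simp add: ennreal_mult)
    also have "\<dots> \<le> ennreal (?A * ?B * (1 + ?K))"
      using A B by (intro ennreal_leI) (simp add: distrib_left)
    finally show ?thesis .
  qed
  let ?M = "{n. J \<inter> block n \<noteq> {}}"
  have M: "finite ?M"
    using J by (intro finite_blocks) (simp add: bounded_intervals_def)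
  consider (no_left) "J \<inter> (\<Union>n. left n) = {}"
    | (no_right) "J \<inter> (\<Union>n. right n) = {}"
    | (many) m n where "m \<in> ?M" "n \<in> ?M" "m \<noteq> n"
    | (single) n y z where "?M = {n}" "y \<in> J" "y \<in> left n" "z \<in> J" "z \<in> right n"
  proof (cases "J \<inter> (\<Union>n. left n) = {} \<or> J \<inter> (\<Union>n. right n) = {}")
    case True
    then show thesis using that(1,2) by blast
  next
    case False
    then obtain y m z n where y: "y \<in> J" "y \<in> left m" and z: "z \<in> J" "z \<in> right n"
      by blast
    then have mn: "m \<in> ?M" "n \<in> ?M"
      using left_subset_block right_subset_block by blast+
    show thesis
    proof (cases "?M = {n}")
      case True
      with mn y z show thesis using that(4)[of n y z] by auto
    next
      case False
      with mn obtain k where "k \<in> ?M" "k \<noteq> n" by blast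
      with mn show thesis using that(3) by blast
    qed
  qed
  then show ?thesis
  proof cases
    case no_left
    \<comment> \<open>The empty set covers the support here, so every positive constant is
      admissible; the product is then \<open>0\<close> whatever \<open>?V\<close> is.\<close>
    have "?U \<le> 0"
    proof (rule ennreal_le_epsilon)
      fix e :: real assume "0 < e"
      then show "?U \<le> 0 + ennreal e"
        using no_left D J \<alpha> llog_norm_u_le[of J D e "{}" \<alpha>] by simp
    qed
    then show ?thesis by simp
  next
    case no_right
    then show ?thesis using D by (intro crude[of "{}"]) auto
  next
    case many
    \<comment> \<open>All spikes in \<open>J\<close> have index at most \<open>N\<close>. Since
      \<open>J\<close> also meets an earlier block, it contains the gap before block
      \<open>N\<close>, which outweighs all of them together.\<close>
    define N where "N = Max ?M"
    have N: "N \<in> ?M" "\<And>k. k \<in> ?M \<Longrightarrow> k \<le> N"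
      using M many(1) Max_in[OF M] by (auto simp: N_def)
    obtain k where k: "k \<in> ?M" "k < N"
      using many N(2)[OF many(1)] N(2)[OF many(2)] by (metis order_le_imp_less_or_eq)
    from k N obtain y z where yz: "y \<in> J" "y \<in> block k" "z \<in> J" "z \<in> block N" by blast
    show ?thesis
    proof (rule crude[of "{..N}"])
      show "2 * (\<Sum>n\<le>N. phi q (2 * q) (height n)) \<le> D"
        using separated[OF k(2) yz(2,4)] D(4)[OF yz(1,3)] by linarith
      fix y n assume "y \<in> J" "y \<in> right n"
      then have "n \<in> ?M" using right_subset_block by blast
      then show "n \<in> {..N}" using N(2) by simp
    qed simp
  next
    case single
    define L where "L = real (Suc n)"
    define T where "T = level p \<alpha> L"
    define W where "W = level q \<beta> L"
    have L: "1 \<le> L" by (simp add: L_def)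
    have T: "0 < T" and W: "0 < W"
      using L by (auto simp: T_def W_def intro!: level_pos)
    have TW: "height n = T * W"
      unfolding T_def W_def L_def using height_eq_levels[OF sum conjugate] by simp
    have dD: "exp L \<le> D"
      using single D(4)[of y z] by (auto simp: left_def right_def L_def)
    have only: "k = n" if "w \<in> J" "w \<in> block k" for w k
      using that single(1) by blast
    \<comment> \<open>The length of \<open>J\<close> is at least \<open>exp L\<close>, so a unit
      interval of height one has norm of order \<open>1 / T\<close>.\<close>
    have "?U \<le> ennreal (?A / T)"
    proof (rule llog_norm_u_le[OF J D(3), where S = "left n"])
      have "phi p \<alpha> (T / ?A) \<le> exp L / 2"
        unfolding T_def using p \<alpha> L by (intro phi_level_slack) auto
      also have "\<dots> \<le> D" using dD exp_gt_zero[of L] by linarith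
      finally show "ennreal (phi p \<alpha> (1 / (?A / T))) * emeasure lebesgue (left n) \<le> ennreal D"
        by (simp add: left_def ennreal_leI)
      show "J \<inter> (\<Union>n. left n) \<subseteq> left n"
        using only left_subset_block by blast
    qed (use D A T \<alpha> in \<open>auto simp: left_def\<close>)
    \<comment> \<open>The \<open>1\<close> accounts for the background and \<open>T\<close> for the
      spike, since \<open>height n / T = W\<close>. Multiplied by \<open>?A / T\<close>, the spike
      contributes a constant and the background \<open>1 / T\<close>.\<close>
    moreover have "?V \<le> ennreal (?B * (1 + T))"
    proof (rule llog_norm_v_le[OF J D(3), where S = "{n}"])
      have "1 / (?B * (1 + T)) \<le> 1 / ?B"
        using B T by (intro divide_left_mono) (auto simp: mult_le_cancel_left1)
      then have "phi q \<beta> (1 / (?B * (1 + T))) \<le> phi q \<beta> (1 / ?B)"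
        using q \<beta> B T by (intro phi_mono) auto
      with phi_B show "phi q \<beta> (1 / (?B * (1 + T))) \<le> 1 / 2" by linarith
      have "height n / (?B * (1 + T)) \<le> (1 + T) * W / (?B * (1 + T))"
        using B T W unfolding TW by (intro divide_right_mono mult_right_mono) auto
      also have "\<dots> = W / ?B" using T by simp
      finally have "phi q \<beta> (height n / (?B * (1 + T))) \<le> phi q \<beta> (W / ?B)"
        using q \<beta> B T h[of n] by (intro phi_mono) auto
      also have "\<dots> \<le> exp L / 2"
        unfolding W_def using q \<beta> L by (intro phi_level_slack) auto
      finally show "(\<Sum>n\<in>{n}. phi q \<beta> (height n / (?B * (1 + T)))) \<le> D / 2"
        using dD by simp
      show "k \<in> {n}" if "w \<in> J" "w \<in> right k" for w k
        using only that right_subset_block by blast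
    qed (use D B T in auto)
    ultimately have "?U * ?V \<le> ennreal (?A / T) * ennreal (?B * (1 + T))"
      by (intro mult_mono) auto
    also have "\<dots> = ennreal (?A / T * (?B * (1 + T)))"
      using A B T by (intro ennreal_mult[symmetric]) auto
    also have "?A / T * (?B * (1 + T)) = ?A * ?B * (1 + 1 / T)"
      using T by (simp add: field_simps)
    also have "ennreal \<dots> \<le> ennreal (?A * ?B * (1 + ?K))"
      using A B inverse_level_bounded[of p \<alpha> L] p \<alpha> L
      by (intro ennreal_leI mult_left_mono) (auto simp: T_def)
    finally show ?thesis .
  qed
qed

lemma SUP_norm_product_finite:
  assumes "0 < \<alpha>" "0 \<le> \<beta>" "\<beta> \<le> 2 * q" "\<alpha> / p + \<beta> / q = 5 / 2"
  shows "(SUP I\<in>bounded_intervals.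
    llog_norm p \<alpha> I (weight_power u (1 / p)) * llog_norm q \<beta> I (weight_power v (- 1 / p))) < \<infinity>"
  using SUP_least[OF norm_product_le[OF _ assms]] ennreal_less_top
  unfolding infinity_ennreal_def by (rule le_less_trans)

section \<open>Unboundedness of the product when the exponents sum to 3\<close>

lemma block_in_bounded_intervals:
  "block n \<in> bounded_intervals" "emeasure lebesgue (block n) \<le> ennreal (2 * exp (real (Suc n)))"
proof -
  have "2 \<le> exp (real (Suc n))"
    using exp_ge_add_one_self[of "real (Suc n)"] by simp
  then show "emeasure lebesgue (block n) \<le> ennreal (2 * exp (real (Suc n)))"
    by (auto simp: block_def simp del: ennreal_plus intro!: ennreal_leI)
  show "block n \<in> bounded_intervals"
    by (simp add: bounded_intervals_def block_def is_interval_cc add_pos_pos)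
qed

text \<open>On \<open>block n\<close> each norm is at least a constant times the spike height over
  the level. As \<open>height n\<close> exceeds the product of the levels by
  \<open>L powr (3 - 5/2)\<close>, the product of the norms is at least a multiple of
  \<open>sqrt L\<close>.\<close>

lemma SUP_norm_product_infinite:
  assumes \<alpha>: "0 \<le> \<alpha>" and \<beta>: "0 \<le> \<beta>" and sum: "\<alpha> / p + \<beta> / q = 3"
  shows "(SUP I\<in>bounded_intervals.
    llog_norm p \<alpha> I (weight_power u (1 / p)) * llog_norm q \<beta> I (weight_power v (- 1 / p))) = \<infinity>"
    (is "?S = _")
proof (rule ccontr)
  assume "?S \<noteq> \<infinity>"
  then obtain r where r: "0 \<le> r" "?S = ennreal r"
    by (cases ?S) auto
  obtain A where A: "0 < A"
    "\<forall>\<^sub>F L in at_top. \<forall>t\<ge>0. phi p \<alpha> t \<le> 2 * exp L \<longrightarrow> t \<le> A * level p \<alpha> L"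
    using phi_le_imp_le_level[of p \<alpha>] p \<alpha> by auto
  obtain B where B: "0 < B"
    "\<forall>\<^sub>F L in at_top. \<forall>t\<ge>0. phi q \<beta> t \<le> 2 * exp L \<longrightarrow> t \<le> B * level q \<beta> L"
    using phi_le_imp_le_level[of q \<beta>] q \<beta> by auto
  \<comment> \<open>This gives \<open>sqrt L \<ge> A * B * (r + 1)\<close>, against the bound
    \<open>sqrt L \<le> r * (A * B)\<close> that follows from finiteness.\<close>
  have "\<forall>\<^sub>F L in at_top. (A * B * (r + 1))\<^sup>2 \<le> L"
    by (rule eventually_ge_at_top)
  with A(2) B(2) have "\<forall>\<^sub>F L in at_top.
      (\<forall>t\<ge>0. phi p \<alpha> t \<le> 2 * exp L \<longrightarrow> t \<le> A * level p \<alpha> L) \<and>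
      (\<forall>t\<ge>0. phi q \<beta> t \<le> 2 * exp L \<longrightarrow> t \<le> B * level q \<beta> L) \<and> (A * B * (r + 1))\<^sup>2 \<le> L"
    by eventually_elim blast
  then obtain L0 where L0: "\<And>L. L0 \<le> L \<Longrightarrow>
      (\<forall>t\<ge>0. phi p \<alpha> t \<le> 2 * exp L \<longrightarrow> t \<le> A * level p \<alpha> L) \<and>
      (\<forall>t\<ge>0. phi q \<beta> t \<le> 2 * exp L \<longrightarrow> t \<le> B * level q \<beta> L) \<and> (A * B * (r + 1))\<^sup>2 \<le> L"
    unfolding eventually_at_top_linorder by blast
  obtain n where n: "L0 \<le> real n" using real_arch_simple by blast
  define L where "L = real (Suc n)"
  have L: "1 \<le> L" "L0 \<le> L" using n by (auto simp: L_def)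
  have lev: "0 < level p \<alpha> L" "0 < level q \<beta> L" using L by (auto intro!: level_pos)
  have h: "1 \<le> height n" by (rule height_ge_1)
  have "ennreal (1 / (A * level p \<alpha> L)) \<le> llog_norm p \<alpha> (block n) (weight_power u (1 / p))"
    by (rule le_llog_norm[OF block_in_bounded_intervals, where S = "left n"])
       (use L0[OF L(2)] A(1) lev left_subset_block
         in \<open>auto simp: left_def weight_power_u L_def indicator_def\<close>)
  moreover have "ennreal (height n / (B * level q \<beta> L))
      \<le> llog_norm q \<beta> (block n) (weight_power v (- 1 / p))"
    by (rule le_llog_norm[OF block_in_bounded_intervals, where S = "right n"])
       (use L0[OF L(2)] B(1) lev right_subset_block h
         in \<open>auto simp: weight_power_v_right lebesgue_right L_def\<close>)
  ultimately have "ennreal (1 / (A * level p \<alpha> L)) * ennreal (height n / (B * level q \<beta> L))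
      \<le> llog_norm p \<alpha> (block n) (weight_power u (1 / p)) *
        llog_norm q \<beta> (block n) (weight_power v (- 1 / p))"
    by (intro mult_mono) auto
  also have "\<dots> \<le> ?S" by (intro SUP_upper block_in_bounded_intervals)
  finally have "ennreal (1 / (A * level p \<alpha> L) * (height n / (B * level q \<beta> L))) \<le> ennreal r"
    using A(1) B(1) lev h r by (subst ennreal_mult) auto
  then have "1 / (A * level p \<alpha> L) * (height n / (B * level q \<beta> L)) \<le> r"
    using r by (simp add: ennreal_le_iff)
  moreover have "1 / (A * level p \<alpha> L) * (height n / (B * level q \<beta> L)) = sqrt L / (A * B)"
  proof -
    have "L powr (- 3) * sqrt L = L powr (- 3 + 1 / 2)"
      using L unfolding powr_add by (simp add: powr_half_sqrt)
    then have "height n = level p \<alpha> L * level q \<beta> L * sqrt L"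
      unfolding level_mult_level[OF conjugate] sum by (simp add: height_def L_def mult.assoc)
    then show ?thesis using A B lev by (simp add: field_simps)
  qed
  ultimately have "sqrt L \<le> r * (A * B)"
    using A B by (simp add: pos_divide_le_eq)
  moreover have "A * B * (r + 1) \<le> sqrt L"
    using L0[OF L(2)] by (intro real_le_rsqrt) auto
  ultimately show False
    using mult_pos_pos[OF A(1) B(1)] by (simp add: algebra_simps)
qed

end

section \<open>Choice of positions and of the exponents\<close>

theorem theorem7p1:
  fixes p p' :: real
  assumes "p > 1" and "1 / p + 1 / p' = 1"
  shows "\<exists>u v. weight u \<and> weight v \<and>
    (SUP I\<in>bounded_intervals.
       llog_norm p (p - 1/2) I (weight_power u (1/p)) *
       llog_norm p' (2 * p' - 1/2) I (weight_power v (- 1/p))) < \<infinity> \<and>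
    (SUP I\<in>bounded_intervals.
       llog_norm p (2 * p - 1/2) I (weight_power u (1/p)) *
       llog_norm p' (p' - 1/2) I (weight_power v (- 1/p))) < \<infinity> \<and>
    (SUP I\<in>bounded_intervals.
       llog_norm p (2 * p - 1) I (weight_power u (1/p)) *
       llog_norm p' (2 * p' - 1) I (weight_power v (- 1/p))) = \<infinity>"
proof -
  have "1 / p < 1" "0 < 1 / p" using assms(1) by auto
  \<comment> \<open>Positivity of \<open>1 / p'\<close> rules out negative \<open>p'\<close> and
    also \<open>p' = 0\<close>, where the quotient is \<open>0\<close> by convention.\<close>
  with assms(2) have "0 < 1 / p'" "1 / p' < 1" by linarith+
  then have p': "1 < p'" by (simp add: divide_less_eq split: if_splits)
  \<comment> \<open>The recursion makes \<open>gap\<close> an equality.\<close>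
  define x where "x = rec_nat (0::real) (\<lambda>n y. y + exp (real (Suc n)) + 2
    + 2 * (\<Sum>j\<le>Suc n. phi p' (2 * p') (height j)))"
  interpret spikes p p' x
    using assms p' by unfold_locales (auto simp: x_def)
  \<comment> \<open>By conjugacy the right-hand sides are \<open>5/2\<close>, \<open>5/2\<close> and
    \<open>3\<close>.\<close>
  have sums: "(p - 1/2) / p + (2 * p' - 1/2) / p' = 3 - (1 / p + 1 / p') / 2"
    "(2 * p - 1/2) / p + (p' - 1/2) / p' = 3 - (1 / p + 1 / p') / 2"
    "(2 * p - 1) / p + (2 * p' - 1) / p' = 4 - (1 / p + 1 / p')"
    using assms(1) p' by (simp_all add: field_simps)
  show ?thesis
    using assms p' sums
    by (intro exI[of _ u] exI[of _ v] conjI weight_u weight_v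
          SUP_norm_product_finite SUP_norm_product_infinite) auto
qed

end
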